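(* Let $(\mathbb{A}_n)_{n\ge 0}$ be a sequence of real algebras obtained by iterated Cayley--Dickson doubling, with $\dim_{\mathbb{R}}\mathbb{A}_n=2^n$. For every $n\ge 0$, writing the elements of $\mathbb{A}_{n+1}$ as $a+\epsilon b$ with $a,b\in\mathbb{A}_n$ and $\epsilon^2=\pm1$ (the sign chosen for this doubling step), and setting $$M_{n+1}(a+\epsilon b)=\begin{pmatrix} a & \epsilon^2\,b^{*}\\ b & a^{*}\end{pmatrix}\in\mathrm{Mat}_2(\mathbb{A}_n),$$ the interlaced product $\circledast$ on $\mathrm{Mat}_2(\mathbb{A}_n)$ reproduces the multiplication of $\mathbb{A}_{n+1}$: $$M_{n+1}(x)\circledast M_{n+1}(y)=M_{n+1}(xy)\qquad\text{for all }x,y\in\mathbb{A}_{n+1}.$$ Consequently, at every level of the tower the multiplication follows the same order-reversal pattern $$\begin{pmatrix} R+L & L+R\\ L+R & R+L\end{pmatrix}:$$ if $M_{n+1}(x)=\begin{pmatrix}\alpha&\beta\\ \gamma&\delta\end{pmatrix}$ and $M_{n+1}(y)=\begin{pmatrix}\alpha'&\beta'\\ \gamma'&\delta'\end{pmatrix}$, then $$M_{n+1}(xy)=\begin{pmatrix}\alpha\alpha'+\gamma'\beta & \beta'\alpha+\beta\delta'\\ \alpha'\gamma+\delta\gamma' & \gamma\beta'+\delta'\delta\end{pmatrix}.$$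
   Context: Cayley--Dickson tower: $\mathbb{A}_0=\mathbb{R}$ with trivial involution. Given $\mathbb{A}_n$ with its standard involution $^{*}$, the algebra $\mathbb{A}_{n+1}$ is the set of formal expressions $a+\epsilon b$ with $a,b\in\mathbb{A}_n$ (so $\mathbb{A}_{n+1}\cong\mathbb{A}_n\oplus\mathbb{A}_n$ as a real vector space), where $\epsilon^2\in\{+1,-1\}$ is a real sign fixed at this step, with multiplication $$(a_1+\epsilon b_1)(a_2+\epsilon b_2)=a_1a_2+\epsilon^2\,b_2b_1^{*}+\epsilon\,(a_2b_1+a_1^{*}b_2)$$ and standard involution $(a+\epsilon b)^{*}=a^{*}-\epsilon b$. The algebras $\mathbb{A}_n$ are in general neither commutative nor associative. The interlaced product $\circledast$ on $\mathrm{Mat}_2(\mathcal{A})$, for any (possibly non-commutative, non-associative) algebra $\mathcal{A}$, is $$\begin{pmatrix} a & b\\ c & d\end{pmatrix}\circledast\begin{pmatrix} a' & b'\\ c' & d'\end{pmatrix}=\begin{pmatrix} aa'+c'b & b'a+bd'\\ a'c+dc' & cb'+d'd\end{pmatrix}.$$ In the $(R+L)$ pattern, each entry of the product is a sum of two products; $R$ denotes the one in the natural order of ordinary matrix multiplication (left-matrix entry times right-matrix entry) and $L$ the one in reversed order. *)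

theory Defs
  imports "Jordan_Normal_Form.VS_Connect"
begin

section \<open>Real algebras with an involution\<close>

text \<open>An algebra is a carrier-based structure, so that all levels of the Cayley--Dickson tower can
  share one type of elements and the level can be an ordinary natural number. No associativity or
  commutativity is built into the record. Real scalars are the ring
  \<open>class_ring :: real ring\<close>.\<close>

record 'a star_alg = "(real, 'a) module" +
  star :: "'a \<Rightarrow> 'a"

locale real_star_algebra = vectorspace "class_ring :: real ring" A for A :: "'a star_alg" +
  assumes mult_closed:
      "\<lbrakk>x \<in> carrier A; y \<in> carrier A\<rbrakk> \<Longrightarrow> x \<otimes>\<^bsub>A\<^esub> y \<in> carrier A"
    and mult_add_left:
      "\<lbrakk>x \<in> carrier A; y \<in> carrier A; z \<in> carrier A\<rbrakk>
        \<Longrightarrow> (x \<oplus>\<^bsub>A\<^esub> y) \<otimes>\<^bsub>A\<^esub> z = x \<otimes>\<^bsub>A\<^esub> z \<oplus>\<^bsub>A\<^esub> y \<otimes>\<^bsub>A\<^esub> z"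
    and mult_add_right:
      "\<lbrakk>x \<in> carrier A; y \<in> carrier A; z \<in> carrier A\<rbrakk>
        \<Longrightarrow> x \<otimes>\<^bsub>A\<^esub> (y \<oplus>\<^bsub>A\<^esub> z) = x \<otimes>\<^bsub>A\<^esub> y \<oplus>\<^bsub>A\<^esub> x \<otimes>\<^bsub>A\<^esub> z"
    and mult_smult_left:
      "\<lbrakk>x \<in> carrier A; y \<in> carrier A\<rbrakk> \<Longrightarrow> (r \<odot>\<^bsub>A\<^esub> x) \<otimes>\<^bsub>A\<^esub> y = r \<odot>\<^bsub>A\<^esub> (x \<otimes>\<^bsub>A\<^esub> y)"
    and mult_smult_right:
      "\<lbrakk>x \<in> carrier A; y \<in> carrier A\<rbrakk> \<Longrightarrow> x \<otimes>\<^bsub>A\<^esub> (r \<odot>\<^bsub>A\<^esub> y) = r \<odot>\<^bsub>A\<^esub> (x \<otimes>\<^bsub>A\<^esub> y)"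
    and one_closed: "\<one>\<^bsub>A\<^esub> \<in> carrier A"
    and one_left: "x \<in> carrier A \<Longrightarrow> \<one>\<^bsub>A\<^esub> \<otimes>\<^bsub>A\<^esub> x = x"
    and one_right: "x \<in> carrier A \<Longrightarrow> x \<otimes>\<^bsub>A\<^esub> \<one>\<^bsub>A\<^esub> = x"
    and star_closed: "x \<in> carrier A \<Longrightarrow> star A x \<in> carrier A"
    and star_add:
      "\<lbrakk>x \<in> carrier A; y \<in> carrier A\<rbrakk> \<Longrightarrow> star A (x \<oplus>\<^bsub>A\<^esub> y) = star A x \<oplus>\<^bsub>A\<^esub> star A y"
    and star_smult: "x \<in> carrier A \<Longrightarrow> star A (r \<odot>\<^bsub>A\<^esub> x) = r \<odot>\<^bsub>A\<^esub> star A x"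
    and star_star: "x \<in> carrier A \<Longrightarrow> star A (star A x) = x"
    and star_one: "star A \<one>\<^bsub>A\<^esub> = \<one>\<^bsub>A\<^esub>"

section \<open>The Cayley--Dickson tower\<close>

text \<open>\<open>Dbl a b\<close> is the formal expression $a + \epsilon b$. The type also contains trees of uneven
  depth; these lie in the carrier of no algebra of the tower.\<close>

datatype cd = Scal (scal: real) | Dbl cd cd

definition cd_real :: "cd star_alg" where
  "cd_real = \<lparr> carrier = range Scal,
     mult = (\<lambda>x y. Scal (scal x * scal y)), one = Scal 1,
     zero = Scal 0, add = (\<lambda>x y. Scal (scal x + scal y)),
     smult = (\<lambda>r x. Scal (r * scal x)),
     star = (\<lambda>x. x) \<rparr>"

text \<open>The real number \<open>e\<close> stands for $\epsilon^2$.\<close>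

definition cd_double :: "real \<Rightarrow> cd star_alg \<Rightarrow> cd star_alg" where
  "cd_double e A = \<lparr> carrier = {Dbl a b | a b. a \<in> carrier A \<and> b \<in> carrier A},
     mult = (\<lambda>x y. case (x, y) of (Dbl a\<^sub>1 b\<^sub>1, Dbl a\<^sub>2 b\<^sub>2) \<Rightarrow>
       Dbl (a\<^sub>1 \<otimes>\<^bsub>A\<^esub> a\<^sub>2 \<oplus>\<^bsub>A\<^esub> e \<odot>\<^bsub>A\<^esub> (b\<^sub>2 \<otimes>\<^bsub>A\<^esub> star A b\<^sub>1))
           (a\<^sub>2 \<otimes>\<^bsub>A\<^esub> b\<^sub>1 \<oplus>\<^bsub>A\<^esub> star A a\<^sub>1 \<otimes>\<^bsub>A\<^esub> b\<^sub>2)),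
     one = Dbl \<one>\<^bsub>A\<^esub> \<zero>\<^bsub>A\<^esub>,
     zero = Dbl \<zero>\<^bsub>A\<^esub> \<zero>\<^bsub>A\<^esub>,
     add = (\<lambda>x y. case (x, y) of (Dbl a\<^sub>1 b\<^sub>1, Dbl a\<^sub>2 b\<^sub>2) \<Rightarrow>
       Dbl (a\<^sub>1 \<oplus>\<^bsub>A\<^esub> a\<^sub>2) (b\<^sub>1 \<oplus>\<^bsub>A\<^esub> b\<^sub>2)),
     smult = (\<lambda>r x. case x of Dbl a b \<Rightarrow> Dbl (r \<odot>\<^bsub>A\<^esub> a) (r \<odot>\<^bsub>A\<^esub> b)),
     star = (\<lambda>x. case x of Dbl a b \<Rightarrow> Dbl (star A a) (\<ominus>\<^bsub>A\<^esub> b)) \<rparr>"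

text \<open>\<open>eps n\<close> is the sign $\epsilon^2$ used in the step from level \<open>n\<close> to level \<open>n + 1\<close>.\<close>

primrec cd_tower :: "(nat \<Rightarrow> real) \<Rightarrow> nat \<Rightarrow> cd star_alg" where
  "cd_tower eps 0 = cd_real"
| "cd_tower eps (Suc n) = cd_double (eps n) (cd_tower eps n)"

section \<open>Two-by-two matrices and the interlaced product\<close>

definition mat2 :: "'a \<Rightarrow> 'a \<Rightarrow> 'a \<Rightarrow> 'a \<Rightarrow> 'a mat" where
  "mat2 a b c d = mat_of_rows_list 2 [[a, b], [c, d]]"

definition Mat2 :: "'a star_alg \<Rightarrow> 'a mat set" where
  "Mat2 A = {M \<in> carrier_mat 2 2. elements_mat M \<subseteq> carrier A}"

text \<open>With rows \<open>(a, b)\<close>, \<open>(c, d)\<close> and \<open>(a', b')\<close>, \<open>(c', d')\<close>, the entries are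
  \<open>aa' + c'b\<close>, \<open>b'a + bd'\<close>, \<open>a'c + dc'\<close>, \<open>cb' + d'd\<close>.\<close>

definition interlaced :: "'a star_alg \<Rightarrow> 'a mat \<Rightarrow> 'a mat \<Rightarrow> 'a mat" where
  "interlaced A M N = mat2
     (M $$ (0,0) \<otimes>\<^bsub>A\<^esub> N $$ (0,0) \<oplus>\<^bsub>A\<^esub> N $$ (1,0) \<otimes>\<^bsub>A\<^esub> M $$ (0,1))
     (N $$ (0,1) \<otimes>\<^bsub>A\<^esub> M $$ (0,0) \<oplus>\<^bsub>A\<^esub> M $$ (0,1) \<otimes>\<^bsub>A\<^esub> N $$ (1,1))
     (N $$ (0,0) \<otimes>\<^bsub>A\<^esub> M $$ (1,0) \<oplus>\<^bsub>A\<^esub> M $$ (1,1) \<otimes>\<^bsub>A\<^esub> N $$ (1,0))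
     (M $$ (1,0) \<otimes>\<^bsub>A\<^esub> N $$ (0,1) \<oplus>\<^bsub>A\<^esub> N $$ (1,1) \<otimes>\<^bsub>A\<^esub> M $$ (1,1))"

text \<open>The matrix $M_{n+1}(a + \epsilon b)$ over \<open>cd_tower eps n\<close>.\<close>

definition cd_matrix :: "(nat \<Rightarrow> real) \<Rightarrow> nat \<Rightarrow> cd \<Rightarrow> cd mat" where
  "cd_matrix eps n x = (case x of Dbl a b \<Rightarrow>
     mat2 a (eps n \<odot>\<^bsub>cd_tower eps n\<^esub> star (cd_tower eps n) b)
          b (star (cd_tower eps n) a))"

section \<open>Basic properties of the construction\<close>

lemma mat2_index [simp]:
  "mat2 a b c d $$ (0,0) = a" "mat2 a b c d $$ (0,1) = b"
  "mat2 a b c d $$ (1,0) = c" "mat2 a b c d $$ (1,1) = d"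
  "mat2 a b c d $$ (0,Suc 0) = b"
  "mat2 a b c d $$ (Suc 0,0) = c" "mat2 a b c d $$ (Suc 0,Suc 0) = d"
  by (simp_all add: mat2_def mat_of_rows_list_def)

lemma mat2_dim [simp]:
  "dim_row (mat2 a b c d) = 2" "dim_col (mat2 a b c d) = 2"
  by (simp_all add: mat2_def mat_of_rows_list_def)

lemma mat2_in_Mat2_iff:
  "mat2 a b c d \<in> Mat2 A \<longleftrightarrow> {a, b, c, d} \<subseteq> carrier A"
proof -
  have "[0..<2] = [0, Suc 0]" by (simp add: numeral_2_eq_2)
  then have "elements_mat (mat2 a b c d) = {a, b, c, d}"
    by (simp add: elements_mat_def insert_commute)
  moreover have "mat2 a b c d \<in> carrier_mat 2 2"
    by (intro carrier_matI mat2_dim)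
  ultimately show ?thesis unfolding Mat2_def by simp
qed

lemma interlaced_mat2:
  "interlaced A (mat2 a b c d) (mat2 a' b' c' d') =
     mat2 (a \<otimes>\<^bsub>A\<^esub> a' \<oplus>\<^bsub>A\<^esub> c' \<otimes>\<^bsub>A\<^esub> b) (b' \<otimes>\<^bsub>A\<^esub> a \<oplus>\<^bsub>A\<^esub> b \<otimes>\<^bsub>A\<^esub> d')
          (a' \<otimes>\<^bsub>A\<^esub> c \<oplus>\<^bsub>A\<^esub> d \<otimes>\<^bsub>A\<^esub> c') (c \<otimes>\<^bsub>A\<^esub> b' \<oplus>\<^bsub>A\<^esub> d' \<otimes>\<^bsub>A\<^esub> d)"
  by (simp add: interlaced_def)

lemma cd_double_simps:
  "carrier (cd_double e A) = {Dbl a b | a b. a \<in> carrier A \<and> b \<in> carrier A}"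
  "Dbl a\<^sub>1 b\<^sub>1 \<otimes>\<^bsub>cd_double e A\<^esub> Dbl a\<^sub>2 b\<^sub>2 =
     Dbl (a\<^sub>1 \<otimes>\<^bsub>A\<^esub> a\<^sub>2 \<oplus>\<^bsub>A\<^esub> e \<odot>\<^bsub>A\<^esub> (b\<^sub>2 \<otimes>\<^bsub>A\<^esub> star A b\<^sub>1))
         (a\<^sub>2 \<otimes>\<^bsub>A\<^esub> b\<^sub>1 \<oplus>\<^bsub>A\<^esub> star A a\<^sub>1 \<otimes>\<^bsub>A\<^esub> b\<^sub>2)"
  "\<one>\<^bsub>cd_double e A\<^esub> = Dbl \<one>\<^bsub>A\<^esub> \<zero>\<^bsub>A\<^esub>"
  "\<zero>\<^bsub>cd_double e A\<^esub> = Dbl \<zero>\<^bsub>A\<^esub> \<zero>\<^bsub>A\<^esub>"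
  "Dbl a\<^sub>1 b\<^sub>1 \<oplus>\<^bsub>cd_double e A\<^esub> Dbl a\<^sub>2 b\<^sub>2 = Dbl (a\<^sub>1 \<oplus>\<^bsub>A\<^esub> a\<^sub>2) (b\<^sub>1 \<oplus>\<^bsub>A\<^esub> b\<^sub>2)"
  "r \<odot>\<^bsub>cd_double e A\<^esub> Dbl a b = Dbl (r \<odot>\<^bsub>A\<^esub> a) (r \<odot>\<^bsub>A\<^esub> b)"
  "star (cd_double e A) (Dbl a b) = Dbl (star A a) (\<ominus>\<^bsub>A\<^esub> b)"
  by (simp_all add: cd_double_def)

lemma cd_real_simps:
  "carrier cd_real = range Scal"
  "Scal r \<otimes>\<^bsub>cd_real\<^esub> Scal t = Scal (r * t)"
  "\<one>\<^bsub>cd_real\<^esub> = Scal 1"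
  "\<zero>\<^bsub>cd_real\<^esub> = Scal 0"
  "Scal r \<oplus>\<^bsub>cd_real\<^esub> Scal t = Scal (r + t)"
  "r \<odot>\<^bsub>cd_real\<^esub> Scal t = Scal (r * t)"
  "star cd_real x = x"
  by (simp_all add: cd_real_def)

lemma real_star_algebra_cd_real: "real_star_algebra cd_real"
proof -
  have ab: "abelian_group cd_real"
  proof (rule abelian_groupI)
    fix x assume "x \<in> carrier cd_real"
    then obtain r where "x = Scal r" by (auto simp: cd_real_simps)
    then show "\<exists>y\<in>carrier cd_real. y \<oplus>\<^bsub>cd_real\<^esub> x = \<zero>\<^bsub>cd_real\<^esub>"
      by (intro bexI[of _ "Scal (- r)"]) (auto simp: cd_real_simps)
  qed (auto simp: cd_real_simps)
  have "module (class_ring :: real ring) cd_real"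
    by (rule moduleI[OF class_cring.is_cring ab])
       (auto simp: cd_real_simps algebra_simps)
  then have "vectorspace (class_ring :: real ring) cd_real"
    unfolding vectorspace_def using class_field by auto
  then show ?thesis
    by (intro real_star_algebra.intro real_star_algebra_axioms.intro)
       (auto simp: cd_real_simps algebra_simps)
qed

lemma (in real_star_algebra) mult_zero:
  assumes "x \<in> carrier A"
  shows "\<zero>\<^bsub>A\<^esub> \<otimes>\<^bsub>A\<^esub> x = \<zero>\<^bsub>A\<^esub>" "x \<otimes>\<^bsub>A\<^esub> \<zero>\<^bsub>A\<^esub> = \<zero>\<^bsub>A\<^esub>"
  using assms mult_smult_left[of x x 0] mult_smult_right[of x x 0]
  by (simp_all add: smult_l_null[simplified] mult_closed)

lemma (in real_star_algebra) star_zero: "star A \<zero>\<^bsub>A\<^esub> = \<zero>\<^bsub>A\<^esub>"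
  using star_smult[of "\<zero>\<^bsub>A\<^esub>" 0] by (simp add: smult_l_null[simplified] star_closed)

lemma real_star_algebra_cd_double:
  assumes "real_star_algebra A"
  shows "real_star_algebra (cd_double e A)"
proof -
  interpret A: real_star_algebra A by fact
  have sc: "r \<odot>\<^bsub>A\<^esub> x \<in> carrier A" if "x \<in> carrier A" for r x
    using A.smult_closed[of r x] that by simp
  have sr: "r \<odot>\<^bsub>A\<^esub> (x \<oplus>\<^bsub>A\<^esub> y) = r \<odot>\<^bsub>A\<^esub> x \<oplus>\<^bsub>A\<^esub> r \<odot>\<^bsub>A\<^esub> y"
    if "x \<in> carrier A" "y \<in> carrier A" for r x y
    using A.smult_r_distr[of r x y] that by simp
  have sl: "(r + t) \<odot>\<^bsub>A\<^esub> x = r \<odot>\<^bsub>A\<^esub> x \<oplus>\<^bsub>A\<^esub> t \<odot>\<^bsub>A\<^esub> x" if "x \<in> carrier A" for r t x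
    using A.smult_l_distr[of r t x] that by simp
  have sa: "(r * t) \<odot>\<^bsub>A\<^esub> x = r \<odot>\<^bsub>A\<^esub> (t \<odot>\<^bsub>A\<^esub> x)" if "x \<in> carrier A" for r t x
    using A.smult_assoc1[of r t x] that by simp
  have s1: "1 \<odot>\<^bsub>A\<^esub> x = x" if "x \<in> carrier A" for x
    using A.smult_one[of x] that by simp
  have s0: "r \<odot>\<^bsub>A\<^esub> \<zero>\<^bsub>A\<^esub> = \<zero>\<^bsub>A\<^esub>" for r
    using A.smult_r_null[of r] by simp
  note cl = sc A.mult_closed A.star_closed A.one_closed
  have ab: "abelian_group (cd_double e A)"
  proof (rule abelian_groupI)
    fix x assume "x \<in> carrier (cd_double e A)"
    then obtain a b where "x = Dbl a b" "a \<in> carrier A" "b \<in> carrier A"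
      by (auto simp: cd_double_simps)
    then show "\<exists>y\<in>carrier (cd_double e A). y \<oplus>\<^bsub>cd_double e A\<^esub> x = \<zero>\<^bsub>cd_double e A\<^esub>"
      by (intro bexI[of _ "Dbl (\<ominus>\<^bsub>A\<^esub> a) (\<ominus>\<^bsub>A\<^esub> b)"]) (auto simp: cd_double_simps A.M.l_neg)
  qed (auto simp: cd_double_simps A.M.a_ac)
  have "module (class_ring :: real ring) (cd_double e A)"
    by (rule moduleI[OF class_cring.is_cring ab])
       (auto simp: cd_double_simps sc sr sl sa s1)
  then have "vectorspace (class_ring :: real ring) (cd_double e A)"
    unfolding vectorspace_def using class_field by auto
  moreover have rm: "r \<odot>\<^bsub>A\<^esub> (\<ominus>\<^bsub>A\<^esub> x) = \<ominus>\<^bsub>A\<^esub> (r \<odot>\<^bsub>A\<^esub> x)" if "x \<in> carrier A" for r x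
    using A.smult_r_minus[of r x] that by simp
  have comm: "e \<odot>\<^bsub>A\<^esub> (r \<odot>\<^bsub>A\<^esub> x) = r \<odot>\<^bsub>A\<^esub> (e \<odot>\<^bsub>A\<^esub> x)" if "x \<in> carrier A" for r x
    using sa[OF that, of e r] sa[OF that, of r e] by (simp add: mult.commute)
  ultimately show ?thesis
  proof (intro real_star_algebra.intro real_star_algebra_axioms.intro)
    fix x y z :: cd and r :: real
    let ?D = "cd_double e A"
    assume x: "x \<in> carrier ?D"
    then obtain a b where [simp]: "x = Dbl a b" "a \<in> carrier A" "b \<in> carrier A"
      by (auto simp: cd_double_simps)
    note [simp] = cd_double_simps cl sr s0 s1 A.star_star A.star_one A.star_zero A.mult_zero
      A.one_left A.one_right A.star_add A.star_smult A.M.minus_add rm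
      A.mult_smult_left A.mult_smult_right comm A.mult_add_left A.mult_add_right
    show "\<one>\<^bsub>?D\<^esub> \<otimes>\<^bsub>?D\<^esub> x = x" by simp
    show "x \<otimes>\<^bsub>?D\<^esub> \<one>\<^bsub>?D\<^esub> = x" by simp
    show "star ?D x \<in> carrier ?D" by simp
    show "star ?D (r \<odot>\<^bsub>?D\<^esub> x) = r \<odot>\<^bsub>?D\<^esub> star ?D x" by simp
    show "star ?D (star ?D x) = x" by simp
    assume y: "y \<in> carrier ?D"
    then obtain c d where [simp]: "y = Dbl c d" "c \<in> carrier A" "d \<in> carrier A"
      by (auto simp: cd_double_simps)
    show "x \<otimes>\<^bsub>?D\<^esub> y \<in> carrier ?D" by simp
    show "(r \<odot>\<^bsub>?D\<^esub> x) \<otimes>\<^bsub>?D\<^esub> y = r \<odot>\<^bsub>?D\<^esub> (x \<otimes>\<^bsub>?D\<^esub> y)" by simp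
    show "x \<otimes>\<^bsub>?D\<^esub> (r \<odot>\<^bsub>?D\<^esub> y) = r \<odot>\<^bsub>?D\<^esub> (x \<otimes>\<^bsub>?D\<^esub> y)" by simp
    show "star ?D (x \<oplus>\<^bsub>?D\<^esub> y) = star ?D x \<oplus>\<^bsub>?D\<^esub> star ?D y" by simp
    assume z: "z \<in> carrier ?D"
    then obtain a' b' where [simp]: "z = Dbl a' b'" "a' \<in> carrier A" "b' \<in> carrier A"
      by (auto simp: cd_double_simps)
    show "(x \<oplus>\<^bsub>?D\<^esub> y) \<otimes>\<^bsub>?D\<^esub> z = x \<otimes>\<^bsub>?D\<^esub> z \<oplus>\<^bsub>?D\<^esub> y \<otimes>\<^bsub>?D\<^esub> z"
      by (simp add: A.M.a_ac)
    show "x \<otimes>\<^bsub>?D\<^esub> (y \<oplus>\<^bsub>?D\<^esub> z) = x \<otimes>\<^bsub>?D\<^esub> y \<oplus>\<^bsub>?D\<^esub> x \<otimes>\<^bsub>?D\<^esub> z"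
      by (simp add: A.M.a_ac)
  qed (auto simp: cd_double_simps A.one_closed A.star_one)
qed

theorem real_star_algebra_cd_tower: "real_star_algebra (cd_tower eps n)"
  by (induction n) (simp_all add: real_star_algebra_cd_real real_star_algebra_cd_double)

lemma cd_matrix_in_Mat2:
  assumes "x \<in> carrier (cd_tower eps (Suc n))"
  shows "cd_matrix eps n x \<in> Mat2 (cd_tower eps n)"
proof -
  interpret A: real_star_algebra "cd_tower eps n" by (rule real_star_algebra_cd_tower)
  show ?thesis
    using assms A.smult_closed
    by (auto simp: cd_double_simps cd_matrix_def mat2_in_Mat2_iff A.star_closed)
qed

primrec coords :: "cd \<Rightarrow> real list" where
  "coords (Scal r) = [r]"
| "coords (Dbl a b) = coords a @ coords b"

lemma length_coords: "x \<in> carrier (cd_tower eps n) \<Longrightarrow> length (coords x) = 2 ^ n"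
  by (induction n arbitrary: x) (auto simp: cd_real_simps cd_double_simps)

lemma inj_on_coords: "inj_on coords (carrier (cd_tower eps n))"
proof (induction n)
  case 0
  show ?case by (auto simp: inj_on_def cd_real_simps)
next
  case (Suc n)
  show ?case
    by (rule inj_onI) (auto simp: cd_double_simps length_coords inj_onD[OF Suc])
qed

lemma coords_surj: "length v = 2 ^ n \<Longrightarrow> \<exists>x \<in> carrier (cd_tower eps n). coords x = v"
proof (induction n arbitrary: v)
  case 0
  then obtain r where "v = [r]" by (auto simp: length_Suc_conv)
  then show ?case by (auto simp: cd_real_simps)
next
  case (Suc n)
  obtain a b where "a \<in> carrier (cd_tower eps n)" "coords a = take (2 ^ n) v"
      "b \<in> carrier (cd_tower eps n)" "coords b = drop (2 ^ n) v"
    using Suc.IH[of "take (2 ^ n) v"] Suc.IH[of "drop (2 ^ n) v"] Suc.prems by auto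
  then show ?case
    by (intro bexI[of _ "Dbl a b"]) (auto simp: cd_double_simps)
qed

lemma coords_add:
  "\<lbrakk>x \<in> carrier (cd_tower eps n); y \<in> carrier (cd_tower eps n)\<rbrakk>
    \<Longrightarrow> coords (x \<oplus>\<^bsub>cd_tower eps n\<^esub> y) = map2 (+) (coords x) (coords y)"
  by (induction n arbitrary: x y) (auto simp: cd_real_simps cd_double_simps length_coords)

lemma coords_smult:
  "x \<in> carrier (cd_tower eps n) \<Longrightarrow> coords (r \<odot>\<^bsub>cd_tower eps n\<^esub> x) = map ((*) r) (coords x)"
  by (induction n arbitrary: x) (auto simp: cd_real_simps cd_double_simps)

theorem dim_cd_tower:
  "vectorspace.fin_dim (class_ring :: real ring) (cd_tower eps n)"
  "vectorspace.dim (class_ring :: real ring) (cd_tower eps n) = 2 ^ n"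
proof -
  let ?T = "cd_tower eps n" and ?V = "module_vec TYPE(real) (2 ^ n)"
  let ?K = "class_ring :: real ring"
  define f where "f = (\<lambda>x. vec_of_list (coords x))"
  define g where "g = the_inv_into (carrier ?T) f"
  interpret T: real_star_algebra ?T by (rule real_star_algebra_cd_tower)
  interpret V: vec_space "TYPE(real)" "2 ^ n" .
  have inj: "inj_on f (carrier ?T)"
    using inj_on_coords[of eps n] unfolding f_def inj_on_def by (metis list_vec)
  have surj: "f ` carrier ?T = carrier ?V"
  proof
    show "f ` carrier ?T \<subseteq> carrier ?V"
      by (auto simp: f_def module_vec_simps length_coords intro!: carrier_vecI)
    show "carrier ?V \<subseteq> f ` carrier ?T"
    proof
      fix v assume "v \<in> carrier ?V"
      then have "length (list_of_vec v) = 2 ^ n" by (simp add: module_vec_simps)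
      then obtain x where "x \<in> carrier ?T" "coords x = list_of_vec v"
        using coords_surj by blast
      then show "v \<in> f ` carrier ?T" by (auto simp: f_def image_iff vec_list intro!: bexI[of _ x])
    qed
  qed
  have fadd: "f (x \<oplus>\<^bsub>?T\<^esub> y) = f x + f y" if "x \<in> carrier ?T" "y \<in> carrier ?T" for x y
    using that by (intro eq_vecI) (auto simp: f_def coords_add length_coords vec_of_list_index simp del: vec_of_list_map)
  have fsm: "f (r \<odot>\<^bsub>?T\<^esub> x) = r \<cdot>\<^sub>v f x" if "x \<in> carrier ?T" for r x
    using that by (intro eq_vecI) (auto simp: f_def coords_smult length_coords vec_of_list_index simp del: vec_of_list_map)
  have gf: "g (f x) = x" if "x \<in> carrier ?T" for x
    unfolding g_def using inj that by (rule the_inv_into_f_f)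
  have Vf: "\<exists>x \<in> carrier ?T. v = f x" if "v \<in> carrier ?V" for v
    using that surj by auto
  have Tsm: "r \<odot>\<^bsub>?T\<^esub> x \<in> carrier ?T" if "x \<in> carrier ?T" for r x
    using T.smult_closed[of r x] that by simp
  have gim: "g ` carrier ?V = carrier ?T"
    unfolding surj[symmetric] image_image using gf by auto
  have g_hom: "g \<in> LinearCombinations.module_hom ?K ?V ?T"
    unfolding LinearCombinations.module_hom_def
  proof (intro CollectI conjI ballI)
    show "g \<in> carrier ?V \<rightarrow> carrier ?T" using gim by auto
  next
    show "\<forall>m1 m2. m1 \<in> carrier ?V \<and> m2 \<in> carrier ?V \<longrightarrow>
        g (m1 \<oplus>\<^bsub>?V\<^esub> m2) = g m1 \<oplus>\<^bsub>?T\<^esub> g m2"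
    proof (intro allI impI)
      fix v w assume "v \<in> carrier ?V \<and> w \<in> carrier ?V"
      then obtain x y where "x \<in> carrier ?T" "v = f x" "y \<in> carrier ?T" "w = f y"
        using Vf by blast
      then show "g (v \<oplus>\<^bsub>?V\<^esub> w) = g v \<oplus>\<^bsub>?T\<^esub> g w"
        by (simp add: module_vec_simps gf fadd[symmetric])
    qed
  next
    show "\<forall>r m. r \<in> carrier ?K \<and> m \<in> carrier ?V \<longrightarrow> g (r \<odot>\<^bsub>?V\<^esub> m) = r \<odot>\<^bsub>?T\<^esub> g m"
    proof (intro allI impI)
      fix r v assume "r \<in> carrier ?K \<and> v \<in> carrier ?V"
      then obtain x where "x \<in> carrier ?T" "v = f x"
        using Vf by blast
      then show "g (r \<odot>\<^bsub>?V\<^esub> v) = r \<odot>\<^bsub>?T\<^esub> g v"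
        by (simp add: module_vec_simps gf fsm[symmetric] Tsm)
    qed
  qed
  interpret L: linear_map ?K ?V ?T g
    using V.vectorspace_axioms T.vectorspace_axioms V.module_axioms T.module_axioms g_hom
    by (simp add: linear_map_def mod_hom_def mod_hom_axioms_def)
  show "T.fin_dim" using L.rank_nullity_main(2)[OF V.fin_dim gim] .
  have "L.kerT \<subseteq> {\<zero>\<^bsub>?V\<^esub>}"
  proof
    fix v assume "v \<in> L.kerT"
    then have v: "v \<in> carrier ?V" "g v = \<zero>\<^bsub>?T\<^esub>" by (auto simp: L.ker_def)
    have z: "\<exists>x \<in> carrier ?T. \<zero>\<^bsub>?V\<^esub> = f x"
      by (rule Vf) (simp add: module_vec_simps)
    have "v = f (g v)" "\<zero>\<^bsub>?V\<^esub> = f (g \<zero>\<^bsub>?V\<^esub>)"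
      using Vf[OF v(1)] z gf by auto
    with v(2) L.f0_is_0 show "v \<in> {\<zero>\<^bsub>?V\<^esub>}" by simp
  qed
  then have ker: "L.kerT = {\<zero>\<^bsub>?V\<^esub>}"
    using L.f0_is_0 V.M.zero_closed unfolding L.ker_def by auto
  interpret Ker: vectorspace ?K "V.vs L.kerT"
    by (rule V.subspace_is_vs[OF L.kerT_is_subspace])
  have "Ker.span {} = {\<zero>\<^bsub>?V\<^esub>}"
    using Ker.span_empty by simp
  then have "Ker.dim = 0"
    using Ker.gen_ge_dim[of "{}"] by (simp add: ker)
  moreover have "T.vs L.imT = ?T"
    using gim by (simp add: L.im_def)
  ultimately show "T.dim = 2 ^ n"
    using L.rank_nullity[OF V.fin_dim] V.dim_is_n by simp
qed

end

theory Submission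
  imports Defs
begin

text \<open>
  Two of the four entries of the interlaced product of $M(a_1 + \epsilon b_1)$ and
  $M(a_2 + \epsilon b_2)$, those of the first column, are literally the two components of the
  Cayley--Dickson product, once the real sign \<open>\<epsilon>\<^sup>2\<close> is moved across the multiplication. The second
  column of any $M(z)$ is the image of the first one under the involution, up to swapping the rows
  and multiplying one entry by \<open>\<epsilon>\<^sup>2\<close>. There the claim reduces to the fact that the involution of
  $\mathbb{A}_n$ reverses products: $(uv)^{*} = v^{*}u^{*}$.

  The involution of the reals reverses products because they commute, and doubling preserves the
  property (\<open>star_mult_cd_double\<close>), so every level has it (\<open>star_mult_cd_tower\<close>). Neither
  argument ever brackets three factors, so the loss of associativity along the tower does no harm.
\<close>

context real_star_algebra
begin

lemma smult_closed_real: "x \<in> carrier A \<Longrightarrow> r \<odot>\<^bsub>A\<^esub> x \<in> carrier A"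
  using smult_closed[of r x] by simp

lemma smult_add_right:
  "\<lbrakk>x \<in> carrier A; y \<in> carrier A\<rbrakk>
    \<Longrightarrow> r \<odot>\<^bsub>A\<^esub> (x \<oplus>\<^bsub>A\<^esub> y) = r \<odot>\<^bsub>A\<^esub> x \<oplus>\<^bsub>A\<^esub> r \<odot>\<^bsub>A\<^esub> y"
  using smult_r_distr[of r x y] by simp

text \<open>Writing a negative as a real multiple reduces its behaviour under the product and the
  involution to their linearity.\<close>

lemma minus_eq_smult:
  assumes x: "x \<in> carrier A"
  shows "\<ominus>\<^bsub>A\<^esub> x = (-1) \<odot>\<^bsub>A\<^esub> x"
proof (rule M.minus_equality)
  show "(-1) \<odot>\<^bsub>A\<^esub> x \<oplus>\<^bsub>A\<^esub> x = \<zero>\<^bsub>A\<^esub>"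
    using x smult_l_distr[of "-1" 1 x] smult_one[of x] smult_l_null[of x] by simp
qed (use x in \<open>simp_all add: smult_closed_real\<close>)

lemma mult_minus_left:
  "\<lbrakk>x \<in> carrier A; y \<in> carrier A\<rbrakk> \<Longrightarrow> (\<ominus>\<^bsub>A\<^esub> x) \<otimes>\<^bsub>A\<^esub> y = \<ominus>\<^bsub>A\<^esub> (x \<otimes>\<^bsub>A\<^esub> y)"
  by (simp add: minus_eq_smult mult_smult_left mult_closed)

lemma mult_minus_right:
  "\<lbrakk>x \<in> carrier A; y \<in> carrier A\<rbrakk> \<Longrightarrow> x \<otimes>\<^bsub>A\<^esub> (\<ominus>\<^bsub>A\<^esub> y) = \<ominus>\<^bsub>A\<^esub> (x \<otimes>\<^bsub>A\<^esub> y)"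
  by (simp add: minus_eq_smult mult_smult_right mult_closed)

lemma star_minus: "x \<in> carrier A \<Longrightarrow> star A (\<ominus>\<^bsub>A\<^esub> x) = \<ominus>\<^bsub>A\<^esub> star A x"
  by (simp add: minus_eq_smult star_smult star_closed)

end

text \<open>In the first component of $y^{*}x^{*}$ the signs of $-b_1$ and $-b_2$ cancel, and
  $b_1 b_2^{*}$ is the image of $b_2 b_1^{*}$ under the reversing involution. The second component
  is $-a_1^{*}b_2 - a_2^{**}b_1$, which is $-(a_2 b_1 + a_1^{*}b_2)$ because applying the
  involution twice gives the identity; no product is reversed there.\<close>

lemma star_mult_cd_double:
  assumes A: "real_star_algebra A" and anti: "\<And>u v. \<lbrakk>u \<in> carrier A; v \<in> carrier A\<rbrakk>
      \<Longrightarrow> star A (u \<otimes>\<^bsub>A\<^esub> v) = star A v \<otimes>\<^bsub>A\<^esub> star A u"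
    and x: "x \<in> carrier (cd_double e A)" and y: "y \<in> carrier (cd_double e A)"
  shows "star (cd_double e A) (x \<otimes>\<^bsub>cd_double e A\<^esub> y) =
    star (cd_double e A) y \<otimes>\<^bsub>cd_double e A\<^esub> star (cd_double e A) x"
proof -
  interpret A: real_star_algebra A by (rule A)
  obtain a b c d where "x = Dbl a b" "y = Dbl c d"
    and "a \<in> carrier A" "b \<in> carrier A" "c \<in> carrier A" "d \<in> carrier A"
    using x y by (auto simp: cd_double_simps)
  then show ?thesis
    by (simp add: cd_double_simps anti A.mult_closed A.star_closed A.star_star A.star_add
        A.star_smult A.star_minus A.smult_closed_real A.mult_minus_left A.mult_minus_right
        A.M.minus_add A.M.a_comm)
qed

theorem star_mult_cd_tower:
  "\<lbrakk>x \<in> carrier (cd_tower eps n); y \<in> carrier (cd_tower eps n)\<rbrakk>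
    \<Longrightarrow> star (cd_tower eps n) (x \<otimes>\<^bsub>cd_tower eps n\<^esub> y) =
      star (cd_tower eps n) y \<otimes>\<^bsub>cd_tower eps n\<^esub> star (cd_tower eps n) x"
proof (induction n arbitrary: x y)
  case 0
  then show ?case by (auto simp: cd_real_simps mult.commute)
next
  case (Suc n)
  then show ?case
    using star_mult_cd_double[OF real_star_algebra_cd_tower] by simp
qed

text \<open>The second column needs
  $(\epsilon^2 b_2^{*})a_1 + (\epsilon^2 b_1^{*})a_2^{*} = \epsilon^2 (a_2 b_1 + a_1^{*} b_2)^{*}$
  and
  $b_1(\epsilon^2 b_2^{*}) + a_2^{*}a_1^{*} = (a_1 a_2 + \epsilon^2\, b_2 b_1^{*})^{*}$,
  which both follow by reversing each product on the right.\<close>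

lemma interlaced_cd_matrix:
  assumes x: "x \<in> carrier (cd_tower eps (Suc n))" and y: "y \<in> carrier (cd_tower eps (Suc n))"
  shows "interlaced (cd_tower eps n) (cd_matrix eps n x) (cd_matrix eps n y) =
    cd_matrix eps n (x \<otimes>\<^bsub>cd_tower eps (Suc n)\<^esub> y)"
proof -
  interpret A: real_star_algebra "cd_tower eps n" by (rule real_star_algebra_cd_tower)
  obtain a b c d where "x = Dbl a b" "y = Dbl c d"
    and "a \<in> carrier (cd_tower eps n)" "b \<in> carrier (cd_tower eps n)"
      "c \<in> carrier (cd_tower eps n)" "d \<in> carrier (cd_tower eps n)"
    using x y by (auto simp: cd_double_simps)
  then show ?thesis
    by (simp add: cd_matrix_def interlaced_mat2 cd_double_simps star_mult_cd_tower
        A.mult_closed A.star_closed A.star_star A.star_add A.star_smult A.smult_closed_real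
        A.smult_add_right A.mult_smult_left A.mult_smult_right A.M.a_comm)
qed

theorem theorem4p1:
  fixes eps :: "nat \<Rightarrow> real"
  assumes "\<And>n. eps n \<in> {1, -1}"
  shows "\<forall>n. \<forall>x \<in> carrier (cd_tower eps (Suc n)). \<forall>y \<in> carrier (cd_tower eps (Suc n)).
      interlaced (cd_tower eps n) (cd_matrix eps n x) (cd_matrix eps n y)
        = cd_matrix eps n (x \<otimes>\<^bsub>cd_tower eps (Suc n)\<^esub> y)
    \<and> (\<forall>\<alpha> \<beta> \<gamma> \<delta> \<alpha>' \<beta>' \<gamma>' \<delta>'.
          cd_matrix eps n x = mat2 \<alpha> \<beta> \<gamma> \<delta> \<longrightarrow>
          cd_matrix eps n y = mat2 \<alpha>' \<beta>' \<gamma>' \<delta>' \<longrightarrow>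
          cd_matrix eps n (x \<otimes>\<^bsub>cd_tower eps (Suc n)\<^esub> y) =
            mat2 (\<alpha> \<otimes>\<^bsub>cd_tower eps n\<^esub> \<alpha>' \<oplus>\<^bsub>cd_tower eps n\<^esub> \<gamma>' \<otimes>\<^bsub>cd_tower eps n\<^esub> \<beta>)
                 (\<beta>' \<otimes>\<^bsub>cd_tower eps n\<^esub> \<alpha> \<oplus>\<^bsub>cd_tower eps n\<^esub> \<beta> \<otimes>\<^bsub>cd_tower eps n\<^esub> \<delta>')
                 (\<alpha>' \<otimes>\<^bsub>cd_tower eps n\<^esub> \<gamma> \<oplus>\<^bsub>cd_tower eps n\<^esub> \<delta> \<otimes>\<^bsub>cd_tower eps n\<^esub> \<gamma>')
                 (\<gamma> \<otimes>\<^bsub>cd_tower eps n\<^esub> \<beta>' \<oplus>\<^bsub>cd_tower eps n\<^esub> \<delta>' \<otimes>\<^bsub>cd_tower eps n\<^esub> \<delta>))"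
  using interlaced_cd_matrix interlaced_mat2 by metis

end
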